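(* Let $A\in\mathbb{C}^{n\times n}$ and let $Z$ be the eigenprojection of $A$ (at eigenvalue $0$). Suppose that $\lambda_1,\ldots,\lambda_s$ are the distinct eigenvalues of $A$ (all of them), $\nu_1,\ldots,\nu_s$ are their respective indices, and the integers $u_1,\ldots,u_s$ are such that $u_i\ge\nu_i$ for $i=1,\ldots,s$. Let $u$ be an integer with $u\ge\operatorname{ind}A$. Then $$Z=\prod_{i:\,\lambda_i\ne0}\Bigl(I-(A/\lambda_i)^{u}\Bigr)^{u_i}$$ and, for all $k=1,\ldots,s$ and $j=0,\ldots,\nu_k-1$, $$Z_{kj}=\left(\prod_{i\ne k}\left(I-\left(\frac{A-\lambda_kI}{\lambda_i-\lambda_k}\right)^{u_k}\right)^{u_i}\right)(j!)^{-1}(A-\lambda_kI)^j,$$ where the product is over $i\in\{1,\ldots,s\}\setminus\{k\}$ and $Z_{kj}$ is the order $j$ component of $A$ corresponding to $\lambda_k$.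
   Context: $I$ is the $n\times n$ identity matrix; $M^0=I$ for every square matrix $M$, and an empty product of matrices equals $I$. All factors in the products are polynomials in $A$, so they commute. The index $\operatorname{ind}A$ of a square matrix $A$ is the smallest integer $k\ge0$ such that $\operatorname{rank}A^{k+1}=\operatorname{rank}A^{k}$ (so $\operatorname{ind}A=0$ if and only if $A$ is nonsingular). The index of an eigenvalue $\lambda_i$ of $A$ is $\nu_i=\operatorname{ind}(A-\lambda_iI)$; equivalently, it is the multiplicity of $\lambda_i$ as a root of the minimal polynomial of $A$. The eigenprojection of $A$ (corresponding to the eigenvalue $0$) is the unique idempotent matrix $Z$ (i.e. $Z^2=Z$) whose range is the null space of $A^{\nu}$ and whose null space is the range of $A^{\nu}$, where $\nu=\operatorname{ind}A$. In particular $Z=0$ if $A$ is nonsingular. The components of $A$ are the uniquely determined matrices $Z_{kj}\in\mathbb{C}^{n\times n}$ ($k=1,\ldots,s$, $j=0,\ldots,\nu_k-1$) such that for every polynomial $f$ with complex coefficients (equivalently, for every function $f$ defined on the spectrum of $A$) $$f(A)=\sum_{k=1}^{s}\sum_{j=0}^{\nu_k-1}f^{(j)}(\lambda_k)\,Z_{kj},$$ where $f^{(j)}$ is the $j$-th derivative of $f$. $Z_{kj}$ is called the order $j$ component of $A$ corresponding to $\lambda_k$. *)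

theory Defs
  imports
    "Jordan_Normal_Form.Spectral_Radius"
    "Jordan_Normal_Form.Matrix_Kernel"
    "Jordan_Normal_Form.DL_Rank"
begin

definition mat_range :: "complex mat \<Rightarrow> complex vec set" where
  "mat_range A = (\<lambda>v. A *\<^sub>v v) ` carrier_vec (dim_col A)"

definition mat_index :: "complex mat \<Rightarrow> nat" where
  "mat_index A = (LEAST k. vec_space.rank (dim_row A) (A ^\<^sub>m (k + 1))
                         = vec_space.rank (dim_row A) (A ^\<^sub>m k))"

definition eigenvalue_index :: "complex mat \<Rightarrow> complex \<Rightarrow> nat" where
  "eigenvalue_index A x = mat_index (A - x \<cdot>\<^sub>m 1\<^sub>m (dim_row A))"

definition is_eigenprojection :: "complex mat \<Rightarrow> complex mat \<Rightarrow> bool" where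
  "is_eigenprojection A Z \<longleftrightarrow>
     Z \<in> carrier_mat (dim_row A) (dim_row A) \<and>
     Z * Z = Z \<and>
     mat_range Z = mat_kernel (A ^\<^sub>m mat_index A) \<and>
     mat_kernel Z = mat_range (A ^\<^sub>m mat_index A)"

definition eigenprojection :: "complex mat \<Rightarrow> complex mat" where
  "eigenprojection A = (THE Z. is_eigenprojection A Z)"

abbreviation cmat_ring :: "nat \<Rightarrow> complex mat ring" where
  "cmat_ring n \<equiv> ring_mat TYPE(complex) n ()"

definition poly_mat :: "complex poly \<Rightarrow> complex mat \<Rightarrow> complex mat" where
  "poly_mat f A =
     (\<Oplus>\<^bsub>cmat_ring (dim_row A)\<^esub>i\<in>{..degree f}. coeff f i \<cdot>\<^sub>m (A ^\<^sub>m i))"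

(* Components are indexed by the eigenvalue itself, not by its position in an enumeration
   of the spectrum.  Values Z x j outside the stated index range are unconstrained. *)
definition is_components :: "complex mat \<Rightarrow> (complex \<Rightarrow> nat \<Rightarrow> complex mat) \<Rightarrow> bool" where
  "is_components A Z \<longleftrightarrow>
     (\<forall>x\<in>spectrum A. \<forall>j<eigenvalue_index A x.
        Z x j \<in> carrier_mat (dim_row A) (dim_row A)) \<and>
     (\<forall>f. poly_mat f A =
        (\<Oplus>\<^bsub>cmat_ring (dim_row A)\<^esub>x\<in>spectrum A.
         \<Oplus>\<^bsub>cmat_ring (dim_row A)\<^esub>j\<in>{..<eigenvalue_index A x}.
           poly ((pderiv ^^ j) f) x \<cdot>\<^sub>m Z x j))"

(* Meaningful for x in the spectrum of A and j below the index of x. *)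
definition component :: "complex mat \<Rightarrow> complex \<Rightarrow> nat \<Rightarrow> complex mat" where
  "component A x j = (THE M. \<exists>Z. is_components A Z \<and> M = Z x j)"

(* Product of n x n matrices over a finite index set, taken in increasing order of the indices
   (matrix multiplication is not commutative); the empty product is the identity. *)
definition mat_prod :: "nat \<Rightarrow> (nat \<Rightarrow> complex mat) \<Rightarrow> nat set \<Rightarrow> complex mat" where
  "mat_prod n F S = foldr (\<lambda>i M. F i * M) (sorted_list_of_set S) (1\<^sub>m n)"

end

theory Submission
  imports Defs
begin

text \<open>
Both formulas are values at \<open>A\<close> of explicit polynomials, and the proof compares
polynomials instead of matrices. Let \<open>\<nu>(x)\<close> be the index of \<open>A - x I\<close>. The
key fact (lemma \<open>poly_mat_eq_0_if_dvd\<close>) is that \<open>q(A) = 0\<close> as soon as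
\<open>q\<close> vanishes to order \<open>\<nu>(x)\<close> at every eigenvalue \<open>x\<close>. Hence
\<open>f(A)\<close> depends only on the derivatives of \<open>f\<close> of order below
\<open>\<nu>(x)\<close> at the eigenvalues \<open>x\<close>.

Consequently, the eigenprojection is \<open>Q(A)\<close> for any polynomial \<open>Q\<close> that is
\<open>1\<close> to order \<open>\<nu>(0)\<close> at \<open>0\<close> and \<open>0\<close> to order
\<open>\<nu>(x)\<close> at each nonzero eigenvalue \<open>x\<close> (lemma
\<open>eigenprojection_eq_poly_mat\<close>). In the same way, the component of order \<open>j\<close> at
\<open>x\<close> is \<open>H(A)\<close> for any \<open>H\<close> whose \<open>j\<close>-th derivative is
\<open>1\<close> at \<open>x\<close> while the other relevant derivatives at all eigenvalues vanish
(lemma \<open>component_eq_poly_mat\<close>).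

The products in the theorem supply such polynomials. The factor
\<open>(1 - ((t - x) / (\<lambda> - x)) ^ m) ^ l\<close> is \<open>1\<close> modulo
\<open>(t - x) ^ m\<close>, and it vanishes to order \<open>l\<close> at \<open>\<lambda>\<close>. So the
product over all eigenvalues \<open>\<lambda> \<noteq> x\<close> is a cutoff: it is \<open>1\<close> near
\<open>x\<close> and \<open>0\<close> near the other eigenvalues, to the orders of contact required.
For \<open>x = 0\<close> it is a \<open>Q\<close> as above, and multiplied by
\<open>(t - x) ^ j / j!\<close> it is an \<open>H\<close>.
\<close>

section \<open>The index and stabilization of ranges\<close>

text \<open>A maximal independent set \<open>S\<close> of columns of \<open>C\<close> is independent inside the
column space of \<open>D\<close>, so it is no larger than the dimension of the latter. If the ranks
agree, \<open>S\<close> is a basis of the larger space and the two spaces coincide. This is what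
turns the rank equation in the definition of the index into a statement about ranges.\<close>

lemma (in vec_space) rank_mono_col_space:
  assumes C: "C \<in> carrier_mat n nc" and D: "D \<in> carrier_mat n nd"
    and sub: "col_space C \<subseteq> col_space D"
  shows "rank C \<le> rank D" and "rank C = rank D \<Longrightarrow> col_space D \<subseteq> col_space C"
proof -
  let ?W = "span (set (cols D))"
  have colsC: "set (cols C) \<subseteq> carrier_vec n" and colsD: "set (cols D) \<subseteq> carrier_vec n"
    using C D cols_dim by blast+
  obtain S where S: "maximal S (\<lambda>T. T \<subseteq> set (cols C) \<and> lin_indpt T)"
    using maximal_exists[of "(\<lambda>T. T \<subseteq> set (cols C) \<and> lin_indpt T)" "card (set (cols C))" "{}"]
    by (meson List.finite_set card_mono empty_iff empty_subsetI finite_lin_indpt2 rev_finite_subset)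
  then have rC: "rank C = card S" using rank_card_indpt[OF C] by blast
  have SC: "S \<subseteq> set (cols C)" and li: "lin_indpt S" using S unfolding maximal_def by auto
  have fS: "finite S" using SC finite_subset by blast
  have subW: "subspace class_ring ?W V" using span_is_subspace colsD by simp
  have smW: "submodule class_ring ?W V" using subW unfolding subspace_def by simp
  interpret W: vectorspace class_ring "vs ?W" using subspace_is_vs[OF subW] .
  have fdW: "W.fin_dim" using fin_dim_span_cols[OF D] .
  have "S \<subseteq> col_space C" unfolding col_space_def using SC in_own_span colsC by auto
  then have SW: "S \<subseteq> ?W" using sub unfolding col_space_def by auto
  have liW: "W.lin_indpt S" using span_li_not_depend(2)[OF SW smW] li by simp
  have le: "card S \<le> W.dim" using W.li_le_dim(2)[OF fdW _ liW] SW by auto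
  then show "rank C \<le> rank D" unfolding rC unfolding rank_def .
  assume "rank C = rank D"
  then have "card S \<ge> W.dim" unfolding rC unfolding rank_def by simp
  then have "W.basis S" using W.dim_li_is_basis[OF fdW fS _ liW] SW by auto
  then have "W.span S = ?W" unfolding W.basis_def by simp
  then have "span S = ?W" using span_li_not_depend(1)[OF SW smW] by simp
  then show "col_space D \<subseteq> col_space C" unfolding col_space_def
    using span_is_monotone[OF SC] by simp
qed

lemma col_space_eq_mat_range:
  assumes "C \<in> carrier_mat n m"
  shows "vec_space.col_space n C = mat_range C"
  using vec_space.col_space_eq[OF assms] assms unfolding mat_range_def by auto

lemma mat_range_pow_Suc:
  assumes B: "B \<in> carrier_mat n n"
  shows "mat_range (B ^\<^sub>m Suc k) \<subseteq> mat_range (B ^\<^sub>m k)"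
  using B by (auto simp: mat_range_def)
     (metis assoc_mult_mat_vec imageI mult_mat_vec_carrier pow_carrier_mat)

lemma rank_pow_Suc:
  assumes B: "B \<in> carrier_mat n n"
  shows "vec_space.rank n (B ^\<^sub>m Suc k) \<le> vec_space.rank n (B ^\<^sub>m k)"
    and "vec_space.rank n (B ^\<^sub>m Suc k) = vec_space.rank n (B ^\<^sub>m k)
      \<Longrightarrow> mat_range (B ^\<^sub>m k) \<subseteq> mat_range (B ^\<^sub>m Suc k)"
proof -
  have c: "B ^\<^sub>m j \<in> carrier_mat n n" for j using B by simp
  note * = vec_space.rank_mono_col_space[OF c[of "Suc k"] c[of k],
    unfolded col_space_eq_mat_range[OF c], OF mat_range_pow_Suc[OF B]]
  show "vec_space.rank n (B ^\<^sub>m Suc k) \<le> vec_space.rank n (B ^\<^sub>m k)"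
    and "vec_space.rank n (B ^\<^sub>m Suc k) = vec_space.rank n (B ^\<^sub>m k)
      \<Longrightarrow> mat_range (B ^\<^sub>m k) \<subseteq> mat_range (B ^\<^sub>m Suc k)"
    using * by blast+
qed

text \<open>The least number in the definition of the index exists: the ranks of the powers decrease weakly
and are natural numbers, so they cannot decrease strictly at every step.\<close>

lemma mat_index_rank:
  assumes B: "B \<in> carrier_mat n n"
  shows "vec_space.rank n (B ^\<^sub>m Suc (mat_index B)) = vec_space.rank n (B ^\<^sub>m mat_index B)"
proof -
  let ?r = "\<lambda>k. vec_space.rank n (B ^\<^sub>m k)"
  have "\<exists>k. ?r (Suc k) = ?r k"
  proof (rule ccontr)
    assume "\<not> ?thesis"
    then have lt: "?r (Suc k) < ?r k" for k
      using rank_pow_Suc(1)[OF B, of k] by (metis le_neq_implies_less)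
    have "?r k + k \<le> ?r 0" for k
    proof (induction k)
      case (Suc k)
      then show ?case using lt[of k] by linarith
    qed simp
    from this[of "Suc (?r 0)"] show False by simp
  qed
  then show ?thesis
    using LeastI_ex[of "\<lambda>k. ?r (k + 1) = ?r k"] B unfolding mat_index_def by auto
qed

text \<open>One further factor \<open>B\<close> does not shrink the range of \<open>B ^ ind B\<close>. The index
enters the annihilation results below through this fact.\<close>

lemma mat_range_index:
  assumes B: "B \<in> carrier_mat n n" and v: "v \<in> carrier_vec n"
  obtains w where "w \<in> carrier_vec n"
    "B ^\<^sub>m mat_index B *\<^sub>v v = B ^\<^sub>m Suc (mat_index B) *\<^sub>v w"
proof -
  have "B ^\<^sub>m mat_index B *\<^sub>v v \<in> mat_range (B ^\<^sub>m mat_index B)"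
    using B v by (auto simp: mat_range_def)
  then have "B ^\<^sub>m mat_index B *\<^sub>v v \<in> mat_range (B ^\<^sub>m Suc (mat_index B))"
    using rank_pow_Suc(2)[OF B mat_index_rank[OF B]] by blast
  then show thesis using that B unfolding mat_range_def by auto
qed

lemma mat_index_eq_0:
  assumes B: "B \<in> carrier_mat n n" and "det B \<noteq> 0"
  shows "mat_index B = 0"
proof -
  have "vec_space.rank n B = n" using assms vec_space.det_rank_iff by blast
  moreover have "vec_space.rank n (1\<^sub>m n :: complex mat) = n"
    using vec_space.det_rank_iff[of "1\<^sub>m n :: complex mat" n] by simp
  ultimately show ?thesis unfolding mat_index_def using B by (intro Least_eq_0) auto
qed

lemma eigenvalue_index_eq_0:
  assumes A: "A \<in> carrier_mat n n" and "x \<notin> spectrum A"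
  shows "eigenvalue_index A x = 0"
proof -
  have "det (A - x \<cdot>\<^sub>m 1\<^sub>m n) \<noteq> 0"
  proof -
    have "char_matrix A x = A - x \<cdot>\<^sub>m 1\<^sub>m n" using A unfolding char_matrix_def by (intro eq_matI) auto
    then show ?thesis using assms eigenvalue_det[OF A, of x] unfolding spectrum_def by simp
  qed
  then show ?thesis unfolding eigenvalue_index_def using A by (auto intro!: mat_index_eq_0)
qed

section \<open>Evaluation of polynomials at a matrix\<close>

lemma finsum_mat_closed:
  assumes "f \<in> S \<rightarrow> carrier_mat n n"
  shows "finsum (cmat_ring n) f S \<in> carrier_mat n n"
proof -
  interpret ring "cmat_ring n" by (rule ring_mat)
  show ?thesis using finsum_closed[of f S] assms by (simp add: ring_mat_simps)
qed

lemma index_finsum_mat: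
  assumes "finite S" "f \<in> S \<rightarrow> carrier_mat n n" "i < n" "j < n"
  shows "finsum (cmat_ring n) f S $$ (i, j) = (\<Sum>x\<in>S. f x $$ (i, j))"
  using assms(1,2)
proof (induction S)
  case empty
  interpret ring "cmat_ring n" by (rule ring_mat)
  show ?case using assms(3,4) by (simp add: ring_mat_simps)
next
  case (insert x S)
  interpret ring "cmat_ring n" by (rule ring_mat)
  have "finsum (cmat_ring n) f (insert x S) = f x + finsum (cmat_ring n) f S"
    using finsum_insert[of S x f] insert by (simp add: ring_mat_simps)
  moreover have "finsum (cmat_ring n) f S \<in> carrier_mat n n"
    using insert by (intro finsum_mat_closed) auto
  ultimately show ?case using insert assms(3,4) by auto
qed

context
  fixes A :: "complex mat" and n :: nat
  assumes A: "A \<in> carrier_mat n n"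
begin

lemma poly_mat_carrier [simp]: "poly_mat f A \<in> carrier_mat n n"
  unfolding poly_mat_def using A by (auto intro!: finsum_mat_closed)

lemma poly_mat_dim [simp]: "dim_row (poly_mat f A) = n" "dim_col (poly_mat f A) = n"
  using carrier_matD[OF poly_mat_carrier[of f]] by simp_all

text \<open>Allowing any bound \<open>N\<close> above the degree makes entries of different polynomials
comparable term by term.\<close>

lemma index_poly_mat:
  assumes "i < n" "j < n" "degree f \<le> N"
  shows "poly_mat f A $$ (i, j) = (\<Sum>k\<le>N. coeff f k * (A ^\<^sub>m k) $$ (i, j))"
proof -
  have "poly_mat f A $$ (i, j) = (\<Sum>k\<le>degree f. coeff f k * (A ^\<^sub>m k) $$ (i, j))"
    unfolding poly_mat_def using A assms(1,2) by (subst index_finsum_mat) auto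
  also have "\<dots> = (\<Sum>k\<le>N. coeff f k * (A ^\<^sub>m k) $$ (i, j))"
    using assms(3) by (intro sum.mono_neutral_left) (auto simp: coeff_eq_0)
  finally show ?thesis .
qed

lemma poly_mat_add: "poly_mat (f + g) A = poly_mat f A + poly_mat g A"
proof (rule eq_matI)
  fix i j assume "i < dim_row (poly_mat f A + poly_mat g A)" "j < dim_col (poly_mat f A + poly_mat g A)"
  then have ij: "i < n" "j < n" by auto
  let ?N = "max (degree f) (degree g)"
  show "poly_mat (f + g) A $$ (i, j) = (poly_mat f A + poly_mat g A) $$ (i, j)"
    using ij index_poly_mat[OF ij, of f ?N] index_poly_mat[OF ij, of g ?N]
      index_poly_mat[OF ij degree_add_le_max, of f g]
    by (simp add: sum.distrib ring_distribs)
qed auto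

lemma poly_mat_smult: "poly_mat (Polynomial.smult c f) A = c \<cdot>\<^sub>m poly_mat f A"
proof (rule eq_matI)
  fix i j assume "i < dim_row (c \<cdot>\<^sub>m poly_mat f A)" "j < dim_col (c \<cdot>\<^sub>m poly_mat f A)"
  then have ij: "i < n" "j < n" by auto
  show "poly_mat (Polynomial.smult c f) A $$ (i, j) = (c \<cdot>\<^sub>m poly_mat f A) $$ (i, j)"
    using ij index_poly_mat[OF ij order.refl, of f] index_poly_mat[OF ij degree_smult_le, of c f]
    by (simp add: sum_distrib_left mult.assoc)
qed auto

lemma poly_mat_0 [simp]: "poly_mat 0 A = 0\<^sub>m n n"
proof -
  have "poly_mat 0 A = 0 \<cdot>\<^sub>m poly_mat 0 A" using poly_mat_smult[of 0 0] by simp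
  also have "\<dots> = 0\<^sub>m n n" by (intro eq_matI) auto
  finally show ?thesis .
qed

text \<open>Horner's rule with the new factor \<open>A\<close> on the right. On this side it matches the
recursion of the matrix power, and it yields multiplicativity below by induction on the second
factor without first showing that polynomials in \<open>A\<close> commute.\<close>

lemma poly_mat_pCons: "poly_mat (pCons c f) A = c \<cdot>\<^sub>m 1\<^sub>m n + poly_mat f A * A"
proof (rule eq_matI)
  fix i j assume "i < dim_row (c \<cdot>\<^sub>m 1\<^sub>m n + poly_mat f A * A)" "j < dim_col (c \<cdot>\<^sub>m 1\<^sub>m n + poly_mat f A * A)"
  then have ij: "i < n" "j < n" using A by auto
  have "poly_mat (pCons c f) A $$ (i, j)
      = (\<Sum>k\<le>Suc (degree f). coeff (pCons c f) k * (A ^\<^sub>m k) $$ (i, j))"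
    by (rule index_poly_mat[OF ij degree_pCons_le])
  also have "\<dots> = c * 1\<^sub>m n $$ (i, j) + (\<Sum>k\<le>degree f. coeff f k * (A ^\<^sub>m k * A) $$ (i, j))"
    using A by (subst sum.atMost_Suc_shift) simp
  also have "(\<Sum>k\<le>degree f. coeff f k * (A ^\<^sub>m k * A) $$ (i, j))
      = (\<Sum>k\<le>degree f. \<Sum>l<n. coeff f k * (A ^\<^sub>m k) $$ (i, l) * A $$ (l, j))"
    using A ij by (intro sum.cong)
      (auto simp: scalar_prod_def sum_distrib_left mult.assoc atLeast0LessThan)
  also have "\<dots> = (\<Sum>l<n. poly_mat f A $$ (i, l) * A $$ (l, j))"
    by (subst sum.swap) (intro sum.cong, auto simp: index_poly_mat[OF ij(1) _ order.refl] sum_distrib_right)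
  also have "\<dots> = (poly_mat f A * A) $$ (i, j)"
    using A ij by (auto simp: scalar_prod_def atLeast0LessThan)
  finally show "poly_mat (pCons c f) A $$ (i, j) = (c \<cdot>\<^sub>m 1\<^sub>m n + poly_mat f A * A) $$ (i, j)"
    using A ij by simp
qed (use A in auto)

lemma poly_mat_mult: "poly_mat (f * g) A = poly_mat f A * poly_mat g A"
proof (induction g)
  case 0
  show ?case using right_mult_zero_mat[OF poly_mat_carrier] by simp
next
  case (pCons b g)
  let ?F = "poly_mat f A" and ?G = "poly_mat g A"
  have "poly_mat (f * pCons b g) A = b \<cdot>\<^sub>m ?F + (0 \<cdot>\<^sub>m 1\<^sub>m n + (?F * ?G) * A)"
    unfolding mult_pCons_right poly_mat_add poly_mat_smult poly_mat_pCons pCons.IH ..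
  also have "0 \<cdot>\<^sub>m 1\<^sub>m n + (?F * ?G) * A = ?F * (?G * A)"
    using A assoc_mult_mat[OF poly_mat_carrier poly_mat_carrier A] by (intro eq_matI) auto
  also have "b \<cdot>\<^sub>m ?F + ?F * (?G * A) = ?F * (b \<cdot>\<^sub>m 1\<^sub>m n + ?G * A)"
    using A mult_smult_distrib[OF poly_mat_carrier, of "1\<^sub>m n" n f b]
     by (subst mult_add_distrib_mat[of _ n n _ n]) (auto simp: right_mult_one_mat[OF poly_mat_carrier])
  finally show ?case unfolding poly_mat_pCons .
qed

lemma poly_mat_1 [simp]: "poly_mat 1 A = 1\<^sub>m n"
  using A unfolding one_pCons poly_mat_pCons by (intro eq_matI) auto

lemma poly_mat_diff: "poly_mat (f - g) A = poly_mat f A - poly_mat g A"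
proof -
  have "poly_mat (f - g) A = poly_mat f A + (- 1) \<cdot>\<^sub>m poly_mat g A"
    using poly_mat_add[of f "Polynomial.smult (-1) g"] poly_mat_smult[of "-1" g] by simp
  then show ?thesis by (intro eq_matI) auto
qed

lemma poly_mat_power: "poly_mat (f ^ k) A = poly_mat f A ^\<^sub>m k"
  by (induction k) (simp_all add: power_Suc2 poly_mat_mult del: power_Suc)

lemma poly_mat_linear: "poly_mat [:- x, 1:] A = A - x \<cdot>\<^sub>m 1\<^sub>m n"
proof -
  have "poly_mat [:- x, 1:] A = - x \<cdot>\<^sub>m 1\<^sub>m n + poly_mat 1 A * A"
    unfolding poly_mat_pCons[of "- x"] one_pCons ..
  then show ?thesis using A by (intro eq_matI) auto
qed

lemma poly_mat_sum:
  "finite S \<Longrightarrow> poly_mat (\<Sum>x\<in>S. F x) A = finsum (cmat_ring n) (\<lambda>x. poly_mat (F x) A) S"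
proof (induction S rule: finite_induct)
  case empty
  interpret ring "cmat_ring n" by (rule ring_mat)
  show ?case by (simp add: ring_mat_simps)
next
  case (insert x S)
  interpret ring "cmat_ring n" by (rule ring_mat)
  show ?case using insert by (simp add: finsum_insert poly_mat_add ring_mat_simps)
qed

lemma mat_prod_poly_mat:
  assumes "finite S"
  shows "mat_prod n (\<lambda>i. poly_mat (F i) A) S = poly_mat (\<Prod>i\<in>S. F i) A"
proof -
  have "foldr (\<lambda>i M. poly_mat (F i) A * M) xs (1\<^sub>m n) = poly_mat (\<Prod>i\<leftarrow>xs. F i) A" for xs
    by (induction xs) (auto simp: poly_mat_mult)
  moreover have "(\<Prod>i\<leftarrow>sorted_list_of_set S. F i) = (\<Prod>i\<in>S. F i)"
    using assms prod.distinct_set_conv_list[of "sorted_list_of_set S" F] by simp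
  ultimately show ?thesis unfolding mat_prod_def by simp
qed

text \<open>The \<open>n\<^sup>2 + 1\<close> powers \<open>I, A, \<dots>, A ^ n\<^sup>2\<close> are linearly
dependent. The dependence is read off from the kernel of a square matrix whose columns list the
entries of these powers, padded with one zero row so that its determinant vanishes. The degree of
the polynomial does not matter later, so this replaces the Cayley-Hamilton theorem.\<close>

lemma nonzero_annihilating_poly_exists:
  obtains p where "p \<noteq> 0" "poly_mat p A = 0\<^sub>m n n"
proof -
  define N where "N = Suc (n * n)"
  define M where "M = mat N N (\<lambda>(r, k). if r < n * n then (A ^\<^sub>m k) $$ (r div n, r mod n) else 0)"
  have M: "M \<in> carrier_mat N N" unfolding M_def by simp
  have "det M = 0"
  proof -
    have "M = mat\<^sub>r N N (\<lambda>i. if i = n * n then 0\<^sub>v N else row M i)"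
      unfolding M_def N_def by (intro eq_matI) auto
    then show ?thesis using det_row_0[of "n * n" N "row M"] M unfolding N_def by fastforce
  qed
  then obtain v where v: "v \<in> carrier_vec N" "v \<noteq> 0\<^sub>v N" "M *\<^sub>v v = 0\<^sub>v N"
    using det_0_iff_vec_prod_zero_field[OF M] by auto
  define p where "p = Poly (list_of_vec v)"
  have cp: "coeff p k = (if k < N then v $ k else 0)" for k
    unfolding p_def using v(1) by (auto simp: nth_default_def)
  have "p \<noteq> 0"
  proof
    assume "p = 0"
    then have "v = 0\<^sub>v N" using v(1) cp by (intro eq_vecI) (auto, metis coeff_0)
    then show False using v(2) by simp
  qed
  moreover have "poly_mat p A = 0\<^sub>m n n"
  proof (rule eq_matI)
    fix i j assume "i < dim_row (0\<^sub>m n n :: complex mat)" "j < dim_col (0\<^sub>m n n :: complex mat)"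
    then have ij: "i < n" "j < n" by auto
    define r where "r = i * n + j"
    have r: "r < n * n" "r div n = i" "r mod n = j"
    proof -
      have "r < Suc i * n" unfolding r_def using ij by simp
      also have "\<dots> \<le> n * n" using ij by (intro mult_le_mono1) simp
      finally show "r < n * n" .
    qed (use ij in \<open>auto simp: r_def\<close>)
    have deg: "degree p \<le> n * n" by (rule degree_le) (simp add: cp N_def)
    have "poly_mat p A $$ (i, j) = (\<Sum>k<N. v $ k * (A ^\<^sub>m k) $$ (i, j))"
      using index_poly_mat[OF ij deg] by (simp add: cp N_def lessThan_Suc_atMost)
    also have "\<dots> = (M *\<^sub>v v) $ r"
      using v(1) r by (auto simp: M_def N_def scalar_prod_def atLeast0LessThan mult.commute)
    also have "\<dots> = 0" using v(3) r by (simp add: N_def)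
    finally show "poly_mat p A $$ (i, j) = 0\<^sub>m n n $$ (i, j)" using ij by simp
  qed auto
  ultimately show thesis using that by blast
qed

end

section \<open>Derivatives and divisibility by powers of linear factors\<close>

lemma higher_pderiv_shift:
  "(pderiv ^^ j) (f \<circ>\<^sub>p [:x, 1:]) = (pderiv ^^ j) f \<circ>\<^sub>p [:x, 1:]" for x :: "'a :: field_char_0"
  by (induction j) (simp_all add: pderiv_pcompose pderiv_pCons)

text \<open>Taylor's formula: the derivatives of \<open>f\<close> at \<open>x\<close> are, up to factorials, the
coefficients of the shifted polynomial, which reduces the two lemmas on derivatives below to
coefficients of monomials.\<close>

lemma poly_higher_pderiv:
  "poly ((pderiv ^^ j) f) x = fact j * coeff (f \<circ>\<^sub>p [:x, 1:]) j" for x :: "'a :: field_char_0"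
proof -
  have "poly ((pderiv ^^ j) f) x = coeff ((pderiv ^^ j) (f \<circ>\<^sub>p [:x, 1:])) 0"
    by (simp add: higher_pderiv_shift pcompose_coeff_0)
  also have "\<dots> = fact j * coeff (f \<circ>\<^sub>p [:x, 1:]) j"
    by (simp add: coeff_higher_pderiv pochhammer_fact)
  finally show ?thesis .
qed

lemma pcompose_power: "(f ^ m) \<circ>\<^sub>p g = (f \<circ>\<^sub>p g) ^ m" for f g :: "'a :: comm_ring_1 poly"
  by (induction m) (simp_all add: pcompose_1 pcompose_mult)

lemma linear_power_dvd_iff_higher_pderiv:
  "[:- x, 1:] ^ m dvd f \<longleftrightarrow> (\<forall>j<m. poly ((pderiv ^^ j) f) x = 0)" for x :: "'a :: field_char_0"
proof -
  let ?s = "\<lambda>f. f \<circ>\<^sub>p [:x, 1:]" and ?t = "\<lambda>f. f \<circ>\<^sub>p [:- x, 1:]"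
  have s: "?s ([:- x, 1:] ^ m) = monom 1 m" and t: "?t (monom 1 m) = [:- x, 1:] ^ m"
    by (simp_all add: pcompose_power pcompose_pCons monom_altdef)
  have "?t (?s f) = f"
    by (simp add: pcompose_assoc[symmetric] pcompose_pCons)
  then have "[:- x, 1:] ^ m dvd f \<longleftrightarrow> monom 1 m dvd ?s f"
    using s t by (metis dvd_def pcompose_mult)
  then show ?thesis by (simp add: monom_1_dvd_iff' poly_higher_pderiv)
qed

lemma higher_pderiv_linear_power:
  "poly ((pderiv ^^ i) ([:- x, 1:] ^ j)) x = (if i = j then fact j else 0)" for x :: "'a :: field_char_0"
  by (simp add: poly_higher_pderiv pcompose_power pcompose_pCons flip: monom_altdef[of 1, simplified])

section \<open>Polynomials that annihilate a matrix\<close>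

lemma mat_eq_0I:
  fixes M :: "'a :: semiring_1 mat"
  assumes M: "M \<in> carrier_mat n m"
    and "\<And>v. v \<in> carrier_vec m \<Longrightarrow> M *\<^sub>v v = 0\<^sub>v n"
  shows "M = 0\<^sub>m n m"
proof (rule eq_matI)
  fix i j assume "i < dim_row (0\<^sub>m n m)" "j < dim_col (0\<^sub>m n m)"
  then have ij: "i < n" "j < m" by auto
  have "M $$ (i, j) = (M *\<^sub>v unit_vec m j) $ i"
    using M ij by (simp add: scalar_prod_right_unit)
  also have "\<dots> = 0" using assms(2)[of "unit_vec m j"] ij by simp
  finally show "M $$ (i, j) = 0\<^sub>m n m $$ (i, j)" using ij by simp
qed (use M in auto)

text \<open>Write \<open>B = A - x I\<close> with index \<open>\<nu>\<close>. Every vector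
\<open>B ^ \<nu> v\<close> has the form \<open>B ^ (\<nu> + 1) w\<close>, so a matrix that kills
the range of \<open>B ^ (\<nu> + 1)\<close> kills the range of \<open>B ^ \<nu>\<close>.\<close>

lemma poly_mat_cancel_linear_factor:
  assumes A: "A \<in> carrier_mat n n"
    and 0: "poly_mat ([:- x, 1:] ^ Suc (eigenvalue_index A x) * r) A = 0\<^sub>m n n"
  shows "poly_mat ([:- x, 1:] ^ eigenvalue_index A x * r) A = 0\<^sub>m n n"
proof -
  define B where "B = A - x \<cdot>\<^sub>m 1\<^sub>m n"
  define R where "R = poly_mat r A"
  have B: "B \<in> carrier_mat n n" and R: "R \<in> carrier_mat n n"
    using A unfolding B_def R_def by auto
  have index: "eigenvalue_index A x = mat_index B"
    using A unfolding eigenvalue_index_def B_def by simp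
  have eq: "poly_mat ([:- x, 1:] ^ k * r) A = R * B ^\<^sub>m k" for k
    using poly_mat_mult[OF A, of r "[:- x, 1:] ^ k"]
    by (simp only: mult.commute[of r] poly_mat_power[OF A] poly_mat_linear[OF A] B_def R_def)
  have "R * B ^\<^sub>m mat_index B = 0\<^sub>m n n"
  proof (rule mat_eq_0I)
    fix v :: "complex vec" assume v: "v \<in> carrier_vec n"
    obtain w where w: "w \<in> carrier_vec n"
        "B ^\<^sub>m mat_index B *\<^sub>v v = B ^\<^sub>m Suc (mat_index B) *\<^sub>v w"
      by (rule mat_range_index[OF B v])
    have "R * B ^\<^sub>m mat_index B *\<^sub>v v = R *\<^sub>v (B ^\<^sub>m mat_index B *\<^sub>v v)"
      by (rule assoc_mult_mat_vec[OF R pow_carrier_mat[OF B] v])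
    also have "\<dots> = R * B ^\<^sub>m Suc (mat_index B) *\<^sub>v w"
      unfolding w(2) by (rule assoc_mult_mat_vec[OF R pow_carrier_mat[OF B] w(1), symmetric])
    also have "\<dots> = 0\<^sub>v n" using 0 w(1) unfolding eq index by auto
    finally show "R * B ^\<^sub>m mat_index B *\<^sub>v v = 0\<^sub>v n" .
  qed (use R B in auto)
  then show ?thesis unfolding eq index .
qed

text \<open>The minimal polynomial of \<open>A\<close> divides \<open>q\<close>. Starting from some nonzero
annihilating \<open>p\<close>, the product \<open>p q\<close> annihilates \<open>A\<close>, and the linear
factors of \<open>p\<close> can be removed one at a time: since \<open>q\<close> already carries the
power \<open>\<nu>\<close> of each linear factor, every removal is an instance of the previous
lemma.\<close>

lemma poly_mat_eq_0_if_dvd: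
  assumes A: "A \<in> carrier_mat n n"
    and dvd: "\<And>x. x \<in> spectrum A \<Longrightarrow> [:- x, 1:] ^ eigenvalue_index A x dvd q"
  shows "poly_mat q A = 0\<^sub>m n n"
proof -
  \<comment> \<open>The index vanishes off the spectrum, so this covers the roots of \<open>p\<close> that are not eigenvalues.\<close>
  have dvd: "[:- x, 1:] ^ eigenvalue_index A x dvd q" for x
    using dvd[of x] eigenvalue_index_eq_0[OF A, of x] by (cases "x \<in> spectrum A") auto
  have "p \<noteq> 0 \<Longrightarrow> poly_mat (p * q) A = 0\<^sub>m n n \<Longrightarrow> poly_mat q A = 0\<^sub>m n n" for p
  proof (induction "degree p" arbitrary: p)
    case 0
    then obtain c where p: "p = [:c:]" using degree_eq_zeroE by metis
    then have "q = Polynomial.smult (1 / c) (p * q)" using 0 by simp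
    then have "poly_mat q A = (1 / c) \<cdot>\<^sub>m poly_mat (p * q) A"
      using poly_mat_smult[OF A] by metis
    then show ?case using 0 by auto
  next
    case (Suc d)
    have "\<not> constant (poly p)" using Suc.hyps(2) constant_degree[of p] by simp
    then obtain x where "poly p x = 0" using fundamental_theorem_of_algebra by blast
    then obtain p' where p: "p = [:- x, 1:] * p'" using poly_eq_0_iff_dvd dvd_def by metis
    have p': "p' \<noteq> 0" using Suc.prems p by auto
    have deg: "d = degree p'" using Suc.hyps(2) degree_mult_eq[of "[:- x, 1:]" p'] p' p by auto
    obtain r where "p' * q = [:- x, 1:] ^ eigenvalue_index A x * r"
      using dvd_mult[OF dvd[of x], of p'] by (rule dvdE)
    moreover from this have "p * q = [:- x, 1:] ^ Suc (eigenvalue_index A x) * r"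
      unfolding p by (metis mult.assoc power_Suc)
    ultimately have "poly_mat (p' * q) A = 0\<^sub>m n n"
      using poly_mat_cancel_linear_factor[OF A, of x r] Suc.prems(2) by simp
    then show ?case using Suc.hyps(1)[OF deg p'] by blast
  qed
  then show ?thesis using nonzero_annihilating_poly_exists[OF A]
    poly_mat_mult[OF A] poly_mat_carrier[OF A] by (metis left_mult_zero_mat)
qed

lemma poly_mat_cong:
  assumes A: "A \<in> carrier_mat n n"
    and "\<And>x. x \<in> spectrum A \<Longrightarrow> [:- x, 1:] ^ eigenvalue_index A x dvd f - g"
  shows "poly_mat f A = poly_mat g A"
proof -
  have "poly_mat ((f - g) + g) A = poly_mat (f - g) A + poly_mat g A" by (rule poly_mat_add[OF A])
  also have "poly_mat (f - g) A = 0\<^sub>m n n" by (rule poly_mat_eq_0_if_dvd[OF assms])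
  finally show ?thesis using poly_mat_carrier[OF A, of g] by simp
qed

section \<open>The eigenprojection as a polynomial value\<close>

lemma eigenvalue_index_0:
  assumes "A \<in> carrier_mat n n"
  shows "eigenvalue_index A 0 = mat_index A"
proof -
  have "A - 0 \<cdot>\<^sub>m 1\<^sub>m n = A" using assms by (intro eq_matI) auto
  then show ?thesis using assms unfolding eigenvalue_index_def by simp
qed

text \<open>A vector splits as \<open>v = Z v + (v - Z v)\<close>. If \<open>Y\<close> has the same range and
kernel as \<open>Z\<close>, it fixes the first summand and kills the second one.\<close>

lemma eigenprojection_unique:
  assumes A: "A \<in> carrier_mat n n"
    and Y: "is_eigenprojection A Y" and Z: "is_eigenprojection A Z"
  shows "Y = Z"
proof -
  have c: "Y \<in> carrier_mat n n" "Z \<in> carrier_mat n n"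
    and id: "Y * Y = Y" "Z * Z = Z"
    and range: "mat_range Y = mat_range Z" and ker: "mat_kernel Y = mat_kernel Z"
    using A Y Z unfolding is_eigenprojection_def by auto
  have "Y - Z = 0\<^sub>m n n"
  proof (rule mat_eq_0I)
    fix v :: "complex vec" assume v: "v \<in> carrier_vec n"
    have Zv: "Z *\<^sub>v v \<in> carrier_vec n" using c v by simp
    have "Z *\<^sub>v v \<in> mat_range Y" unfolding range using c v by (auto simp: mat_range_def)
    then obtain w where "w \<in> carrier_vec n" "Z *\<^sub>v v = Y *\<^sub>v w"
      using c by (auto simp: mat_range_def)
    then have 1: "Y *\<^sub>v (Z *\<^sub>v v) = Z *\<^sub>v v"
      using id(1) c assoc_mult_mat_vec by metis
    have "Z *\<^sub>v (v - Z *\<^sub>v v) = 0\<^sub>v n"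
      using c v id(2) Zv assoc_mult_mat_vec[OF c(2) c(2) v]
      by (simp add: mult_minus_distrib_mat_vec[OF c(2)])
    then have "v - Z *\<^sub>v v \<in> mat_kernel Z" using c v by (intro mat_kernelI) auto
    then have "Y *\<^sub>v (v - Z *\<^sub>v v) = 0\<^sub>v n" unfolding ker[symmetric] using c mat_kernelD by blast
    then have "Y *\<^sub>v v - Z *\<^sub>v v = 0\<^sub>v n"
      using 1 by (simp add: mult_minus_distrib_mat_vec[OF c(1) v Zv])
    then show "(Y - Z) *\<^sub>v v = 0\<^sub>v n" using minus_mult_distrib_mat_vec[OF c v] by simp
  qed (use c in auto)
  show ?thesis
  proof (rule eq_matI)
    fix i j assume ij: "i < dim_row Z" "j < dim_col Z"
    then have "(Y - Z) $$ (i, j) = 0" using \<open>Y - Z = 0\<^sub>m n n\<close> c by simp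
    then show "Y $$ (i, j) = Z $$ (i, j)" using ij by simp
  qed (use c in auto)
qed

text \<open>Let \<open>\<nu>\<close> be the index of \<open>A\<close>. The polynomials \<open>x ^ \<nu> Q\<close> and
\<open>(Q - 1) Q\<close> vanish on the spectrum to the required orders, hence
\<open>A ^ \<nu> Z = 0\<close> and \<open>Z\<close> is idempotent. Writing
\<open>Q = 1 - x ^ \<nu> R\<close> shows that \<open>Z\<close> is the identity on the kernel of
\<open>A ^ \<nu>\<close>, and that \<open>Z v = 0\<close> forces \<open>v = A ^ \<nu> R(A) v\<close>.\<close>

lemma eigenprojection_eq_poly_mat:
  assumes A: "A \<in> carrier_mat n n"
    and at_0: "[:0, 1:] ^ mat_index A dvd Q - 1"
    and at_nonzero: "\<And>x. x \<in> spectrum A \<Longrightarrow> x \<noteq> 0 \<Longrightarrow> [:- x, 1:] ^ eigenvalue_index A x dvd Q"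
  shows "eigenprojection A = poly_mat Q A"
proof -
  define Z where "Z = poly_mat Q A"
  define P where "P = A ^\<^sub>m mat_index A"
  let ?X = "[:0, 1:] ^ mat_index A :: complex poly"
  have Z: "Z \<in> carrier_mat n n" and P: "P \<in> carrier_mat n n"
    using A unfolding Z_def P_def by auto
  have "A - 0 \<cdot>\<^sub>m 1\<^sub>m n = A" using A by (intro eq_matI) auto
  then have X: "poly_mat ?X A = P"
    using poly_mat_linear[OF A, of 0] by (simp add: poly_mat_power[OF A] P_def)
  obtain R' where R': "1 - Q = ?X * R'" using at_0 by (subst (asm) dvd_diff_commute) (rule dvdE)
  define R where "R = poly_mat R' A"
  have R: "R \<in> carrier_mat n n" using A unfolding R_def by simp
  have "Q = 1 - ?X * R'" "Q = 1 - R' * ?X" using R' by (simp_all add: algebra_simps)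
  then have ZPR: "Z = 1\<^sub>m n - P * R" and ZRP: "Z = 1\<^sub>m n - R * P"
    unfolding Z_def R_def using X
    by (metis poly_mat_diff[OF A] poly_mat_mult[OF A] poly_mat_1[OF A])+
  have zero: "poly_mat (f * g) A = 0\<^sub>m n n" if "?X dvd f" "Q dvd g" for f g
  proof (rule poly_mat_eq_0_if_dvd[OF A])
    fix x assume x: "x \<in> spectrum A"
    show "[:- x, 1:] ^ eigenvalue_index A x dvd f * g"
    proof (cases "x = 0")
      case True
      then show ?thesis using that(1) eigenvalue_index_0[OF A] by simp
    next
      case False
      then show ?thesis using at_nonzero[OF x] that(2) dvd_trans dvd_mult by blast
    qed
  qed
  have PZ: "P * Z = 0\<^sub>m n n" and ZP: "Z * P = 0\<^sub>m n n"
    using zero[of ?X Q] X by (simp_all add: Z_def poly_mat_mult[OF A, symmetric] mult.commute flip: X)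
  have "Z * Z = Z"
  proof -
    have "(Q - 1) * Q + Q = Q * Q" by (simp add: algebra_simps)
    then have "Z * Z = poly_mat ((Q - 1) * Q) A + Z"
      unfolding Z_def by (metis poly_mat_add[OF A] poly_mat_mult[OF A])
    then show ?thesis using zero[of "Q - 1" Q] at_0 Z by simp
  qed
  moreover have "mat_range Z = mat_kernel P"
  proof
    show "mat_range Z \<subseteq> mat_kernel P"
      using Z P PZ by (auto simp: mat_range_def assoc_mult_mat_vec[OF P Z, symmetric] intro!: mat_kernelI)
    show "mat_kernel P \<subseteq> mat_range Z"
    proof
      fix v assume "v \<in> mat_kernel P"
      then have v: "v \<in> carrier_vec n" "P *\<^sub>v v = 0\<^sub>v n" using mat_kernelD[OF P] by auto
      have "Z *\<^sub>v v = v - R *\<^sub>v (P *\<^sub>v v)"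
        unfolding ZRP using R P v(1)
        by (simp add: minus_mult_distrib_mat_vec[of _ n n] assoc_mult_mat_vec[OF R P])
      moreover have "R *\<^sub>v 0\<^sub>v n = 0\<^sub>v n" using R by (intro eq_vecI) auto
      ultimately have "v = Z *\<^sub>v v" using v by simp
      then show "v \<in> mat_range Z" using v Z by (auto simp: mat_range_def)
    qed
  qed
  moreover have "mat_kernel Z = mat_range P"
  proof
    show "mat_range P \<subseteq> mat_kernel Z"
      using Z P ZP by (auto simp: mat_range_def assoc_mult_mat_vec[OF Z P, symmetric] intro!: mat_kernelI)
    show "mat_kernel Z \<subseteq> mat_range P"
    proof
      fix v assume "v \<in> mat_kernel Z"
      then have v: "v \<in> carrier_vec n" "Z *\<^sub>v v = 0\<^sub>v n" using mat_kernelD[OF Z] by auto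
      have "Z *\<^sub>v v = v - P *\<^sub>v (R *\<^sub>v v)"
        unfolding ZPR using R P v(1)
        by (simp add: minus_mult_distrib_mat_vec[of _ n n] assoc_mult_mat_vec[OF P R])
      then have diff: "v - P *\<^sub>v (R *\<^sub>v v) = 0\<^sub>v n" using v by simp
      have "v = P *\<^sub>v (R *\<^sub>v v)"
      proof (rule eq_vecI)
        fix i assume "i < dim_vec (P *\<^sub>v (R *\<^sub>v v))"
        then show "v $ i = (P *\<^sub>v (R *\<^sub>v v)) $ i"
          using arg_cong[OF diff, of "\<lambda>w. w $ i"] P by simp
      qed (use v P in auto)
      then show "v \<in> mat_range P" using v P R by (auto simp: mat_range_def)
    qed
  qed
  ultimately have "is_eigenprojection A Z"
    unfolding is_eigenprojection_def P_def using Z A by simp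
  then show ?thesis unfolding eigenprojection_def Z_def[symmetric]
    using eigenprojection_unique[OF A] by (intro the_equality) auto
qed

section \<open>Components as polynomial values\<close>

text \<open>The polynomials \<open>H x j\<close> form a Hermite interpolation basis on the spectrum. Subtracting
from \<open>f\<close> its Hermite interpolant leaves a polynomial that annihilates \<open>A\<close>,
so the matrices \<open>H x j (A)\<close> are components. Conversely, evaluating the defining equation
of any family of components at \<open>f = H x j\<close> isolates a single summand.\<close>

lemma component_eq_poly_mat:
  assumes A: "A \<in> carrier_mat n n"
    and H: "\<And>x j y i. x \<in> spectrum A \<Longrightarrow> j < eigenvalue_index A x \<Longrightarrow>
      y \<in> spectrum A \<Longrightarrow> i < eigenvalue_index A y \<Longrightarrow>
      poly ((pderiv ^^ i) (H x j)) y = (if y = x \<and> i = j then 1 else 0)"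
    and x: "x \<in> spectrum A" and j: "j < eigenvalue_index A x"
  shows "component A x j = poly_mat (H x j) A"
proof -
  let ?S = "spectrum A" and ?nu = "eigenvalue_index A"
  have fin: "finite ?S" using card_finite_spectrum[OF A] by simp
  have dA: "dim_row A = n" using A by simp
  interpret R: ring "cmat_ring n" by (rule ring_mat)
  have ex: "is_components A (\<lambda>x j. poly_mat (H x j) A)"
    unfolding is_components_def dA
  proof (intro conjI ballI allI impI)
    fix f :: "complex poly"
    \<comment> \<open>The Hermite interpolant of \<open>f\<close>.\<close>
    define g where "g = (\<Sum>y\<in>?S. \<Sum>i<?nu y. Polynomial.smult (poly ((pderiv ^^ i) f) y) (H y i))"
    have "poly_mat f A = poly_mat g A"
    proof (rule poly_mat_cong[OF A])
      fix y assume y: "y \<in> ?S"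
      have "poly ((pderiv ^^ i) (f - g)) y = 0" if i: "i < ?nu y" for i
      proof -
        have "poly ((pderiv ^^ i) g) y
            = (\<Sum>z\<in>?S. \<Sum>l<?nu z. poly ((pderiv ^^ l) f) z * poly ((pderiv ^^ i) (H z l)) y)"
          unfolding g_def by (simp add: higher_pderiv_sum higher_pderiv_smult poly_sum)
        also have "\<dots> = (\<Sum>z\<in>?S. \<Sum>l<?nu z. if z = y \<and> l = i then poly ((pderiv ^^ i) f) y else 0)"
          using y i by (intro sum.cong refl) (auto simp: H)
        also have "\<dots> = (\<Sum>z\<in>?S. if z = y then poly ((pderiv ^^ i) f) y else 0)"
          using i by (intro sum.cong refl) auto
        also have "\<dots> = poly ((pderiv ^^ i) f) y" using y fin by simp
        finally show ?thesis by (simp add: poly_higher_pderiv pcompose_diff algebra_simps)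
      qed
      then show "[:- y, 1:] ^ ?nu y dvd f - g"
        by (simp add: linear_power_dvd_iff_higher_pderiv)
    qed
    also have "\<dots> = (\<Oplus>\<^bsub>cmat_ring n\<^esub>y\<in>?S. \<Oplus>\<^bsub>cmat_ring n\<^esub>i\<in>{..<?nu y}.
        poly ((pderiv ^^ i) f) y \<cdot>\<^sub>m poly_mat (H y i) A)"
      unfolding g_def by (simp add: poly_mat_sum[OF A] fin poly_mat_smult[OF A])
    finally show "poly_mat f A = (\<Oplus>\<^bsub>cmat_ring n\<^esub>y\<in>?S. \<Oplus>\<^bsub>cmat_ring n\<^esub>i\<in>{..<?nu y}.
        poly ((pderiv ^^ i) f) y \<cdot>\<^sub>m poly_mat (H y i) A)" .
  qed (use A in auto)
  have uniq: "Z x j = poly_mat (H x j) A" if Z: "is_components A Z" for Z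
  proof (rule eq_matI)
    have Zc: "Z y i \<in> carrier_mat n n" if "y \<in> ?S" "i < ?nu y" for y i
      using Z that unfolding is_components_def dA by blast
    then show "dim_row (Z x j) = dim_row (poly_mat (H x j) A)"
      "dim_col (Z x j) = dim_col (poly_mat (H x j) A)" using A x j by auto
    fix a b assume "a < dim_row (poly_mat (H x j) A)" "b < dim_col (poly_mat (H x j) A)"
    then have ab: "a < n" "b < n" using A by auto
    let ?t = "\<lambda>y i. poly ((pderiv ^^ i) (H x j)) y \<cdot>\<^sub>m Z y i"
    have inner: "finsum (cmat_ring n) (?t y) {..<?nu y} \<in> carrier_mat n n" if "y \<in> ?S" for y
      using Zc that by (intro finsum_mat_closed) auto
    have "poly_mat (H x j) A = (\<Oplus>\<^bsub>cmat_ring n\<^esub>y\<in>?S. \<Oplus>\<^bsub>cmat_ring n\<^esub>i\<in>{..<?nu y}. ?t y i)"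
      using Z unfolding is_components_def dA by blast
    then have "poly_mat (H x j) A $$ (a, b)
        = (\<Sum>y\<in>?S. finsum (cmat_ring n) (?t y) {..<?nu y} $$ (a, b))"
      using inner ab fin by (simp add: index_finsum_mat)
    also have "\<dots> = (\<Sum>y\<in>?S. \<Sum>i<?nu y. ?t y i $$ (a, b))"
      using Zc ab by (intro sum.cong refl index_finsum_mat) auto
    also have "\<dots> = (\<Sum>y\<in>?S. \<Sum>i<?nu y. if y = x \<and> i = j then Z x j $$ (a, b) else 0)"
      using Zc ab carrier_matD[OF Zc] by (intro sum.cong refl) (auto simp: H[OF x j])
    also have "\<dots> = (\<Sum>y\<in>?S. if y = x then Z x j $$ (a, b) else 0)"
      using j by (intro sum.cong refl) auto
    also have "\<dots> = Z x j $$ (a, b)" using x fin by simp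
    finally show "Z x j $$ (a, b) = poly_mat (H x j) A $$ (a, b)" ..
  qed
  show ?thesis unfolding component_def using ex uniq by (intro the_equality) blast+
qed

section \<open>Cutoff polynomials and the product formulas\<close>

lemma dvd_power_minus_one: "d dvd f - 1 \<Longrightarrow> d dvd f ^ k - 1" for d f :: "'a :: comm_ring_1"
proof (induction k)
  case (Suc k)
  have "f ^ Suc k - 1 = f * (f ^ k - 1) + (f - 1)" by (simp add: algebra_simps)
  then show ?case using Suc by (metis dvd_add dvd_mult)
qed simp

lemma dvd_prod_minus_one:
  "finite S \<Longrightarrow> (\<And>i. i \<in> S \<Longrightarrow> d dvd F i - 1) \<Longrightarrow> d dvd (\<Prod>i\<in>S. F i) - 1"
  for d :: "'a :: comm_ring_1"
proof (induction S rule: finite_induct)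
  case (insert i S)
  have eq: "F i * (\<Prod>i\<in>S. F i) - 1 = F i * ((\<Prod>i\<in>S. F i) - 1) + (F i - 1)"
    by (simp add: algebra_simps)
  have "d dvd F i * (\<Prod>i\<in>S. F i) - 1"
    unfolding eq using insert by (intro dvd_add dvd_mult) auto
  then show ?case using insert.hyps by simp
qed simp

text \<open>The polynomial behind both products: it is \<open>1\<close> to order \<open>m\<close> at \<open>x\<close>
and \<open>0\<close> to order \<open>us i\<close> at each \<open>lam i \<noteq> x\<close> with \<open>i \<in> S\<close>. For \<open>x = 0\<close>
its value at \<open>A\<close> is the eigenprojection; \<open>x = lam k\<close> serves the components.\<close>

definition cutoff_poly :: "(nat \<Rightarrow> complex) \<Rightarrow> (nat \<Rightarrow> nat) \<Rightarrow> nat set \<Rightarrow> complex \<Rightarrow> nat \<Rightarrow> complex poly" where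
  "cutoff_poly lam us S x m =
    (\<Prod>i\<in>S. (1 - Polynomial.smult (1 / (lam i - x)) [:- x, 1:] ^ m) ^ us i)"

lemma cutoff_poly_minus_one:
  assumes "finite S"
  shows "[:- x, 1:] ^ m dvd cutoff_poly lam us S x m - 1"
  unfolding cutoff_poly_def
proof (rule dvd_prod_minus_one[OF assms], rule dvd_power_minus_one)
  fix i
  show "[:- x, 1:] ^ m dvd 1 - Polynomial.smult (1 / (lam i - x)) [:- x, 1:] ^ m - 1"
    by (simp add: smult_power dvd_smult del: smult_pCons)
qed

text \<open>The bracket in the factor belonging to \<open>i\<close> has a root at \<open>lam i\<close>, because
the scaling by \<open>1 / (lam i - x)\<close> makes it \<open>1 - 1 ^ m\<close> there.\<close>

lemma cutoff_poly_dvd: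
  assumes "finite S" "i \<in> S" "lam i \<noteq> x" "k \<le> us i"
  shows "[:- lam i, 1:] ^ k dvd cutoff_poly lam us S x m"
proof -
  let ?f = "1 - Polynomial.smult (1 / (lam i - x)) [:- x, 1:] ^ m"
  have "poly ?f (lam i) = 1 - (1 / (lam i - x) * poly [:- x, 1:] (lam i)) ^ m"
    by (simp only: poly_diff poly_power poly_smult poly_1)
  also have "\<dots> = 0" using assms(3) by simp
  finally have "poly ?f (lam i) = 0" .
  then have "[:- lam i, 1:] dvd ?f" by (simp only: poly_eq_0_iff_dvd)
  then have "[:- lam i, 1:] ^ k dvd ?f ^ us i"
    using assms(4) by (meson dvd_power_same dvd_trans le_imp_power_dvd)
  also have "?f ^ us i dvd cutoff_poly lam us S x m"
    unfolding cutoff_poly_def using assms(1,2) by (rule dvd_prodI)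
  finally show ?thesis .
qed

lemma poly_mat_cutoff_poly:
  assumes A: "A \<in> carrier_mat n n" and "finite S"
  shows "poly_mat (cutoff_poly lam us S x m) A =
    mat_prod n (\<lambda>i. (1\<^sub>m n - ((1 / (lam i - x)) \<cdot>\<^sub>m (A - x \<cdot>\<^sub>m 1\<^sub>m n)) ^\<^sub>m m) ^\<^sub>m us i) S"
  unfolding cutoff_poly_def mat_prod_poly_mat[OF assms, symmetric]
  by (simp only: poly_mat_power[OF A] poly_mat_diff[OF A] poly_mat_1[OF A] poly_mat_smult[OF A]
      poly_mat_linear[OF A])

theorem proposition2:
  fixes A :: "complex mat" and n s u :: nat
    and lam :: "nat \<Rightarrow> complex" and nu us :: "nat \<Rightarrow> nat"
  assumes A: "A \<in> carrier_mat n n"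
    and eigenvalues: "bij_betw lam {1..s} (spectrum A)"
    and indices: "\<forall>i\<in>{1..s}. nu i = eigenvalue_index A (lam i)"
    and us: "\<forall>i\<in>{1..s}. us i \<ge> nu i"
    and u: "u \<ge> mat_index A"
  shows "eigenprojection A =
           mat_prod n (\<lambda>i. (1\<^sub>m n - ((1 / lam i) \<cdot>\<^sub>m A) ^\<^sub>m u) ^\<^sub>m us i) {i\<in>{1..s}. lam i \<noteq> 0} \<and>
         (\<forall>k\<in>{1..s}. \<forall>j<nu k.
           component A (lam k) j =
             mat_prod n
               (\<lambda>i. (1\<^sub>m n - ((1 / (lam i - lam k)) \<cdot>\<^sub>m (A - lam k \<cdot>\<^sub>m 1\<^sub>m n)) ^\<^sub>m us k) ^\<^sub>m us i)
               ({1..s} - {k})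
             * ((1 / fact j) \<cdot>\<^sub>m (A - lam k \<cdot>\<^sub>m 1\<^sub>m n) ^\<^sub>m j))"
proof (intro conjI ballI allI impI)
  let ?S = "{i\<in>{1..s}. lam i \<noteq> 0}"
  have spectrum: "spectrum A = lam ` {1..s}" using eigenvalues by (simp add: bij_betw_def)
  have inj: "inj_on lam {1..s}" using eigenvalues by (simp add: bij_betw_def)
  have us': "eigenvalue_index A (lam i) \<le> us i" if "i \<in> {1..s}" for i
    using that indices us by simp
  have A0: "A - 0 \<cdot>\<^sub>m 1\<^sub>m n = A" using A by (intro eq_matI) auto
  have "eigenprojection A = poly_mat (cutoff_poly lam us ?S 0 u) A"
  proof (rule eigenprojection_eq_poly_mat[OF A])
    have "[:0, 1:] ^ u dvd cutoff_poly lam us ?S 0 u - 1"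
      using cutoff_poly_minus_one[of ?S 0 u lam us] by simp
    then show "[:0, 1:] ^ mat_index A dvd cutoff_poly lam us ?S 0 u - 1"
      using le_imp_power_dvd[OF u] dvd_trans by blast
    show "[:- x, 1:] ^ eigenvalue_index A x dvd cutoff_poly lam us ?S 0 u"
      if "x \<in> spectrum A" "x \<noteq> 0" for x
      using that us' unfolding spectrum by (auto intro!: cutoff_poly_dvd)
  qed
  also have "\<dots> = mat_prod n (\<lambda>i. (1\<^sub>m n - ((1 / lam i) \<cdot>\<^sub>m A) ^\<^sub>m u) ^\<^sub>m us i) ?S"
    by (simp add: poly_mat_cutoff_poly[OF A] A0)
  finally show "eigenprojection A =
    mat_prod n (\<lambda>i. (1\<^sub>m n - ((1 / lam i) \<cdot>\<^sub>m A) ^\<^sub>m u) ^\<^sub>m us i) ?S" .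

  define P where "P k = cutoff_poly lam us ({1..s} - {k}) (lam k) (us k)" for k
  \<comment> \<open>Modulo \<open>(x - lam k) ^ us k\<close> this is \<open>(x - lam k) ^ j / j!\<close>, and it vanishes
    to the required order at the other eigenvalues.\<close>
  define G where "G k j = P k * Polynomial.smult (1 / fact j) ([:- lam k, 1:] ^ j)" for k j
  \<comment> \<open>The Hermite basis is indexed by eigenvalues, the product formula by their positions.\<close>
  define idx where "idx = the_inv_into {1..s} lam"
  have idx: "idx (lam k) = k" if "k \<in> {1..s}" for k
    unfolding idx_def using the_inv_into_f_f[OF inj that] .
  have G: "poly ((pderiv ^^ i) (G k j)) (lam l) = (if lam l = lam k \<and> i = j then 1 else 0)"
    if kl: "k \<in> {1..s}" "l \<in> {1..s}" and i: "i < eigenvalue_index A (lam l)" for k j l i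
  proof (cases "l = k")
    case True
    let ?h = "Polynomial.smult (1 / fact j) ([:- lam k, 1:] ^ j)"
    have "[:- lam k, 1:] ^ us k dvd P k - 1"
      unfolding P_def by (rule cutoff_poly_minus_one) simp
    then have "[:- lam k, 1:] ^ us k dvd (P k - 1) * ?h" by (rule dvd_mult2)
    then have "poly ((pderiv ^^ i) ((P k - 1) * ?h)) (lam k) = 0"
      using i us'[OF kl(1)] True by (simp only: linear_power_dvd_iff_higher_pderiv)
    moreover have "G k j = (P k - 1) * ?h + ?h"
      unfolding G_def by (simp only: left_diff_distrib mult_1_left diff_add_cancel)
    ultimately show ?thesis using True
      by (simp add: higher_pderiv_add higher_pderiv_smult higher_pderiv_linear_power)
  next
    case False
    then have ne: "lam l \<noteq> lam k" using inj kl by (meson inj_onD)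
    have "[:- lam l, 1:] ^ eigenvalue_index A (lam l) dvd P k"
      unfolding P_def using kl False ne us' by (intro cutoff_poly_dvd) auto
    then have "[:- lam l, 1:] ^ eigenvalue_index A (lam l) dvd G k j"
      unfolding G_def by (rule dvd_mult2)
    then show ?thesis using i ne by (simp add: linear_power_dvd_iff_higher_pderiv)
  qed
  fix k j assume k: "k \<in> {1..s}" and j: "j < nu k"
  have "component A (lam k) j = poly_mat (G (idx (lam k)) j) A"
    using k j indices idx
    by (intro component_eq_poly_mat[OF A, where H = "\<lambda>x. G (idx x)"]) (auto simp: spectrum G)
  also have "\<dots> = poly_mat (G k j) A" using idx[OF k] by simp
  also have "\<dots> = mat_prod n
       (\<lambda>i. (1\<^sub>m n - ((1 / (lam i - lam k)) \<cdot>\<^sub>m (A - lam k \<cdot>\<^sub>m 1\<^sub>m n)) ^\<^sub>m us k) ^\<^sub>m us i) ({1..s} - {k})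
      * ((1 / fact j) \<cdot>\<^sub>m (A - lam k \<cdot>\<^sub>m 1\<^sub>m n) ^\<^sub>m j)"
    unfolding G_def P_def
    by (simp only: poly_mat_mult[OF A] poly_mat_smult[OF A] poly_mat_power[OF A] poly_mat_linear[OF A]
        poly_mat_cutoff_poly[OF A] finite_Diff finite_atLeastAtMost)
  finally show "component A (lam k) j = mat_prod n
       (\<lambda>i. (1\<^sub>m n - ((1 / (lam i - lam k)) \<cdot>\<^sub>m (A - lam k \<cdot>\<^sub>m 1\<^sub>m n)) ^\<^sub>m us k) ^\<^sub>m us i) ({1..s} - {k})
      * ((1 / fact j) \<cdot>\<^sub>m (A - lam k \<cdot>\<^sub>m 1\<^sub>m n) ^\<^sub>m j)" .
qed

end
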